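(* Let $\mathtt{k}>0$, $\nu>-\mathtt{k}$ and $c\in\mathbb{R}$. Then for all $x>0$ the following identities hold: \begin{align*} &(1)\quad 2\nu\,\mathtt{W}^{\mathtt{k}}_{\nu,c}(x)=x\,\mathtt{W}^{\mathtt{k}}_{\nu-\mathtt{k},c}(x)+x\,c\,\mathtt{k}\,\mathtt{W}^{\mathtt{k}}_{\nu+\mathtt{k},c}(x);\\ &(2)\quad \mathtt{W}^{\mathtt{k}}_{\nu-\mathtt{k},c}(x)=\frac{2}{x}\sum_{r=0}^\infty(-1)^r c^r\mathtt{k}^r(\nu+2r\mathtt{k})\,\mathtt{W}^{\mathtt{k}}_{\nu+2r\mathtt{k},c}(x);\\ &(3)\quad \frac{d}{dx}\left(x^{\frac{\nu}{\mathtt{k}}}\mathtt{W}^{\mathtt{k}}_{\nu,c}(x)\right)=\frac{x^{\frac{\nu}{\mathtt{k}}}}{\mathtt{k}}\,\mathtt{W}^{\mathtt{k}}_{\nu-\mathtt{k},c}(x);\\ &(4)\quad \frac{d}{dx}\left(x^{-\frac{\nu}{\mathtt{k}}}\mathtt{W}^{\mathtt{k}}_{\nu,c}(x)\right)=-c\,x^{-\frac{\nu}{\mathtt{k}}}\,\mathtt{W}^{\mathtt{k}}_{\nu+\mathtt{k},c}(x);\\ &(5)\quad \frac{d^m}{dx^m}\left(\mathtt{W}^{\mathtt{k}}_{\nu,c}(x)\right)=\frac{1}{2^m\mathtt{k}^m}\sum_{n=0}^m(-1)^n\binom{m}{n}c^n\mathtt{k}^n\,\mathtt{W}^{\mathtt{k}}_{\nu-m\mathtt{k}+2n\mathtt{k},c}(x)\quad\text{for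 all } m\in\mathbb{N},\ m\ge 1. \end{align*}
   Context: For $\mathtt{k}>0$, the $\mathtt{k}$-gamma function is $\Gamma_{\mathtt{k}}(z)=\int_0^\infty t^{z-1}e^{-t^{\mathtt{k}}/\mathtt{k}}\,dt$ for $\operatorname{Re}(z)>0$; it satisfies $\Gamma_{\mathtt{k}}(z+\mathtt{k})=z\,\Gamma_{\mathtt{k}}(z)$ and is extended through this relation to all $z$ outside $\{0,-\mathtt{k},-2\mathtt{k},\dots\}$ (equivalently $\Gamma_{\mathtt{k}}(z)=\mathtt{k}^{z/\mathtt{k}-1}\Gamma(z/\mathtt{k})$); at the poles $z\in\{0,-\mathtt{k},-2\mathtt{k},\dots\}$ one sets $1/\Gamma_{\mathtt{k}}(z)=0$. For real order $\nu$, real $c$ and $x>0$, the generalized $\mathtt{k}$-Bessel function is $$\mathtt{W}^{\mathtt{k}}_{\nu,c}(x)=\sum_{r=0}^\infty\frac{(-c)^r}{\Gamma_{\mathtt{k}}(r\mathtt{k}+\nu+\mathtt{k})\,r!}\left(\frac{x}{2}\right)^{2r+\frac{\nu}{\mathtt{k}}}.$$ Zeroth powers equal $1$, also when $c=0$. *)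

theory Defs
  imports "HOL-Analysis.Analysis"
begin

text \<open>
  The k-gamma function at real arguments (the Bessel function below has real order, so no other
  arguments occur). It is the integral for positive \<open>z\<close>; for \<open>z \<le> 0\<close> it is obtained by reading
  \<open>\<Gamma>\<^sub>k(z + k) = z \<Gamma>\<^sub>k(z)\<close> from right to left. At the poles \<open>0, -k, -2k, \<dots>\<close> the recursion reaches
  a division by zero, so the value there is \<open>0\<close> (as for \<^const>\<open>Gamma\<close>) and \<open>1 / \<Gamma>\<^sub>k(z) = 0\<close>;
  see \<open>inverse_k_Gamma_pole\<close>. The case \<open>k \<le> 0\<close> is meaningless and only included for termination.
\<close>
function k_Gamma :: "real \<Rightarrow> real \<Rightarrow> real" where
  "k_Gamma k z =
     (if k \<le> 0 \<or> z > 0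
      then integral {0<..} (\<lambda>t. t powr (z - 1) * exp (- (t powr k) / k))
      else k_Gamma k (z + k) / z)"
  by auto
termination
proof (relation "Wellfounded.measure (\<lambda>(k, z). nat \<lfloor>1 - z / k\<rfloor>)", goal_cases)
  case 1
  show ?case by simp
next
  case (2 k z)
  then have "k > 0" and "z \<le> 0" by auto
  then have "1 - (z + k) / k = (1 - z / k) - 1" and "1 \<le> \<lfloor>1 - z / k\<rfloor>"
    by (auto simp: field_simps le_floor_iff)
  then have "\<lfloor>1 - (z + k) / k\<rfloor> = \<lfloor>1 - z / k\<rfloor> - 1" and "1 \<le> \<lfloor>1 - z / k\<rfloor>"
    by linarith+
  then show ?case by simp
qed

declare k_Gamma.simps [simp del]

lemma inverse_k_Gamma_pole:
  assumes "k > 0"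
  shows "1 / k_Gamma k (- (real n * k)) = 0"
proof -
  have "k_Gamma k (- (real n * k)) = 0"
  proof (induction n)
    case 0
    show ?case using assms by (subst k_Gamma.simps) simp
  next
    case (Suc n)
    have "- (real (Suc n) * k) + k = - (real n * k)" by (simp add: algebra_simps)
    moreover have "\<not> (k \<le> 0 \<or> - (real (Suc n) * k) > 0)"
      using assms by (simp add: not_less)
    ultimately show ?case using Suc by (subst k_Gamma.simps) simp
  qed
  then show ?thesis by simp
qed

definition k_Bessel_W :: "real \<Rightarrow> real \<Rightarrow> real \<Rightarrow> real \<Rightarrow> real" where
  "k_Bessel_W k \<nu> c x =
     (\<Sum>r. (- c) ^ r / (k_Gamma k (real r * k + \<nu> + k) * fact r)
           * (x / 2) powr (2 * real r + \<nu> / k))"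

end

theory Submission
  imports Defs
begin

text \<open>
  For \<open>x > 0\<close> the power \<open>(x / 2) powr (\<nu> / k)\<close> can be taken out of the Bessel series, leaving an
  entire function of \<open>y = (x / 2)\<^sup>2\<close>:
  \<open>W \<nu> x = (x / 2) powr (\<nu> / k) * F (\<nu> + k) y\<close> with
  \<open>F z y = \<Sum>r. (- c) ^ r / \<Gamma>\<^sub>k (z + r k) * y ^ r / r!\<close>
  (\<open>k_Bessel_W_conv_k_Clifford\<close>). Everything then rests on two facts about \<open>F\<close>.
  Differentiating the series shifts its index, so \<open>F' z = - c F (z + k)\<close>
  (\<open>k_Clifford_has_derivative\<close>). The recurrence \<open>1 / \<Gamma>\<^sub>k w = w / \<Gamma>\<^sub>k (w + k)\<close>, applied to each
  coefficient with \<open>w = z + r k\<close>, splits \<open>F z\<close> into the part from \<open>z\<close> and the part from \<open>r k\<close>, giving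
  \<open>F z y = z F (z + k) y - c k y F (z + 2 k) y\<close> (\<open>k_Clifford_contiguous\<close>).

  The contiguous relation at \<open>z = \<nu>\<close> is the three-term recurrence in the order, and the derivative
  rule at \<open>z = \<nu> + k\<close> is the derivative of \<open>x powr (- \<nu> / k) * W \<nu> x\<close>, because the first factor
  cancels the power in front. Undoing that factor with the product rule and eliminating the term
  \<open>\<nu> W \<nu> / x\<close> by the recurrence gives \<open>2 k W' \<nu> = W (\<nu> - k) - c k W (\<nu> + k)\<close>, from which the
  derivative of \<open>x powr (\<nu> / k) * W \<nu> x\<close> follows by the product rule and the recurrence. Applying the
  formula for \<open>W'\<close> repeatedly amounts to expanding the \<open>m\<close>-th power of a sum of two commuting
  index shifts, whence the binomial coefficients in the \<open>m\<close>-th derivative.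

  For the series, the recurrence at order \<open>\<nu> + 2 r k\<close>, multiplied by \<open>(- c k) ^ r\<close>, makes
  the terms telescope. What remains is that \<open>(- c k) ^ r W (\<nu> - k + 2 r k) x\<close> tends to \<open>0\<close>. This
  holds because \<open>1 / \<Gamma>\<^sub>k (z + n k)\<close> decays faster than any geometric sequence in \<open>n\<close>, and hence so
  does \<open>F (z + n k) y\<close> (\<open>k_Clifford_decay\<close>).

  Orders such as \<open>\<nu> - m k\<close> may be negative and reach the poles of the k-gamma function. The
  recurrence for the reciprocal persists there, because both of its sides vanish.
\<close>

section \<open>The recurrence of the k-gamma function\<close>

text \<open>
  Euler's integral for \<open>Gamma (z / k)\<close> turns into the defining integral under the substitution
  \<open>u = t powr k / k\<close>.
\<close>

lemma k_Gamma_conv_Gamma: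
  assumes k: "k > 0" and z: "z > 0"
  shows "k_Gamma k z = k powr (z / k - 1) * Gamma (z / k)"
proof -
  define f :: "real \<Rightarrow> real" where "f = (\<lambda>u. u powr (z / k - 1) / exp u)"
  define g where "g = (\<lambda>t::real. t powr k / k)"
  define g' where "g' = (\<lambda>t::real. t powr (k - 1))"
  define C where "C = k powr (z / k - 1)"
  have der: "(g has_field_derivative g' t) (at t within {0<..})" if "t \<in> {0<..}" for t
  proof -
    have "((\<lambda>t. t powr k / k) has_field_derivative t powr (k - 1)) (at t)"
      using DERIV_cdivide[OF has_real_derivative_powr, of t k k] that k by simp
    then show ?thesis
      unfolding g_def g'_def by (rule has_field_derivative_at_within)
  qed
  have inj: "inj_on g {0<..}"
  proof (rule inj_onI)
    fix s t assume s: "s \<in> {0<..}" and t: "t \<in> {0<..}" and "g s = g t"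
    then have "s powr k = t powr k"
      using k by (simp add: g_def)
    then have "(s powr k) powr (1 / k) = (t powr k) powr (1 / k)"
      by simp
    then show "s = t"
      using k s t by (simp add: powr_powr)
  qed
  have img: "g ` {0<..} = {0<..}"
  proof (intro equalityI subsetI)
    fix u assume "u \<in> g ` {0<..}"
    then show "u \<in> {0<..}" using k by (auto simp: g_def)
  next
    fix u :: real assume u: "u \<in> {0<..}"
    then have "g ((k * u) powr (1 / k)) = u"
      using k by (simp add: g_def powr_powr)
    then show "u \<in> g ` {0<..}"
      using u k by (intro image_eqI[of _ _ "(k * u) powr (1 / k)"]) auto
  qed
  have f_int: "(f has_integral Gamma (z / k)) {0<..}"
  proof -
    have "(f has_integral Gamma (z / k)) {0..}"
      unfolding f_def using Gamma_integral_real[of "z / k"] k z by simp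
    moreover have "negligible {x \<in> {0<..} - {0..}. f x \<noteq> 0}"
        and "negligible {x \<in> {0..} - {0<..}. f x \<noteq> 0}"
      by (rule negligible_subset[of "{0}"]; auto)+
    ultimately show ?thesis
      by (simp add: has_integral_spike_set_eq[of "{0<..}" "{0..}"])
  qed
  then have "f absolutely_integrable_on {0<..}" and "integral {0<..} f = Gamma (z / k)"
    using nonnegative_absolutely_integrable_1[OF has_integral_integrable[OF f_int]]
    by (auto simp: f_def integral_unique)
  then have "integral {0<..} (\<lambda>t. \<bar>g' t\<bar> * f (g t)) = Gamma (z / k)"
    using has_absolute_integral_change_of_variables_1'[of "{0<..}" g g' f "Gamma (z / k)",
        OF _ der inj] img by auto
  moreover have "t powr (z - 1) * exp (- (t powr k) / k) = C * (\<bar>g' t\<bar> * f (g t))"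
    if "t > 0" for t
  proof -
    have "(k * g t) powr (z / k - 1) = t powr (z - k)"
      using k that by (simp add: g_def powr_powr right_diff_distrib)
    moreover have "C * g t powr (z / k - 1) = (k * g t) powr (z / k - 1)"
    proof -
      have "g t \<ge> 0"
        using k by (simp add: g_def)
      then show ?thesis
        using k by (simp add: C_def powr_mult)
    qed
    moreover have "t powr (z - 1) = g' t * t powr (z - k)"
      by (simp add: g'_def flip: powr_add)
    moreover have "exp (- (t powr k) / k) = 1 / exp (g t)"
      by (simp add: g_def exp_minus inverse_eq_divide)
    moreover have "\<bar>g' t\<bar> = g' t"
      by (simp add: g'_def)
    ultimately show ?thesis
      by (simp add: f_def)
  qed
  then have "integral {0<..} (\<lambda>t. t powr (z - 1) * exp (- (t powr k) / k))
      = integral {0<..} (\<lambda>t. C * (\<bar>g' t\<bar> * f (g t)))"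
    by (intro integral_cong) auto
  ultimately show ?thesis
    using z by (subst k_Gamma.simps) (simp add: C_def)
qed

text \<open>
  Stating the recurrence for the reciprocal makes it valid at every real argument. For \<open>z \<le> 0\<close> it
  merely reads the definition backwards, and at \<open>z = 0\<close> both sides vanish; only \<open>z > 0\<close>
  needs the functional equation of \<^const>\<open>Gamma\<close>.
\<close>

lemma inverse_k_Gamma_rec:
  assumes k: "k > 0"
  shows "1 / k_Gamma k z = z * (1 / k_Gamma k (z + k))"
proof (cases "z > 0")
  case True
  have "k_Gamma k (z + k) = z * k_Gamma k z"
  proof -
    have "k_Gamma k (z + k) = k powr (z / k) * Gamma (z / k + 1)"
      using k True by (subst k_Gamma_conv_Gamma) (simp_all add: add_divide_distrib)
    also have "Gamma (z / k + 1) = (z / k) * Gamma (z / k)"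
      using k True by (intro Gamma_plus1) (auto dest: nonpos_Ints_nonpos simp: field_simps)
    also have "k powr (z / k) = k * k powr (z / k - 1)"
      using k by (simp add: powr_diff)
    finally show ?thesis
      using k True by (simp add: k_Gamma_conv_Gamma)
  qed
  then show ?thesis
    using True by simp
next
  case False
  then show ?thesis
    using k by (subst k_Gamma.simps) simp
qed

section \<open>The power series factor\<close>

text \<open>
  This is the analogue of the Bessel--Clifford function: for \<open>k = 1\<close> and \<open>c = - 1\<close> it is the
  confluent hypergeometric limit function \<open>\<^sub>0F\<^sub>1(; z; y)\<close> divided by \<open>Gamma z\<close>.
\<close>

definition k_Clifford :: "real \<Rightarrow> real \<Rightarrow> real \<Rightarrow> real \<Rightarrow> real" where
  "k_Clifford k c z y = (\<Sum>r. (- c) ^ r * (1 / k_Gamma k (z + real r * k)) / fact r * y ^ r)"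

text \<open>
  By the recurrence, the ratio of consecutive terms is \<open>q / (z + n k)\<close>, which tends to \<open>0\<close>.
\<close>

lemma summable_inverse_k_Gamma:
  assumes k: "k > 0"
  shows "summable (\<lambda>n. (1 / k_Gamma k (z + real n * k)) * q ^ n)"
proof (rule summable_ratio_test[where c = "1 / 2" and N = "nat \<lceil>(2 * \<bar>q\<bar> + \<bar>z\<bar>) / k\<rceil>"])
  fix n assume "nat \<lceil>(2 * \<bar>q\<bar> + \<bar>z\<bar>) / k\<rceil> \<le> n"
  then have "(2 * \<bar>q\<bar> + \<bar>z\<bar>) / k \<le> real n"
    by linarith
  then have "2 * \<bar>q\<bar> + \<bar>z\<bar> \<le> real n * k"
    using k by (simp add: field_simps)
  then have q: "2 * \<bar>q\<bar> \<le> \<bar>z + real n * k\<bar>"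
    by linarith
  define A where "A = 1 / k_Gamma k (z + real (Suc n) * k)"
  have "1 / k_Gamma k (z + real n * k) = (z + real n * k) * A"
    using inverse_k_Gamma_rec[OF k, of "z + real n * k"] by (simp add: A_def algebra_simps)
  moreover have "2 * \<bar>q\<bar> * (\<bar>A\<bar> * \<bar>q\<bar> ^ n) \<le> \<bar>z + real n * k\<bar> * (\<bar>A\<bar> * \<bar>q\<bar> ^ n)"
    by (intro mult_right_mono q) simp
  ultimately show "norm (1 / k_Gamma k (z + real (Suc n) * k) * q ^ Suc n)
      \<le> 1 / 2 * norm (1 / k_Gamma k (z + real n * k) * q ^ n)"
    unfolding A_def[symmetric] by (simp add: abs_mult power_abs mult_ac)
qed simp

lemma inverse_k_Gamma_bound:
  assumes k: "k > 0" and p: "p > 0"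
  obtains B where "\<And>n. \<bar>1 / k_Gamma k (z + real n * k)\<bar> \<le> B * p ^ n"
proof -
  have "Bseq (\<lambda>n. (1 / k_Gamma k (z + real n * k)) * (1 / p) ^ n)"
    by (intro summable_imp_Bseq summable_inverse_k_Gamma k)
  then obtain B where B:
      "\<And>n. norm ((1 / k_Gamma k (z + real n * k)) * (1 / p) ^ n) \<le> B"
    by (auto simp: Bseq_def)
  show ?thesis
  proof (rule that)
    fix n
    show "\<bar>1 / k_Gamma k (z + real n * k)\<bar> \<le> B * p ^ n"
    proof -
      have "\<bar>1 / k_Gamma k (z + real n * k)\<bar> / p ^ n \<le> B"
        using B[of n] p by (simp add: abs_mult power_one_over power_abs field_simps)
      then show ?thesis
        using p by (simp only: pos_divide_le_eq zero_less_power)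
    qed
  qed
qed

text \<open>
  Since the coefficients depend on \<open>n + r\<close> only, the geometric bound on them separates the shift
  \<open>n\<close> from the summation index \<open>r\<close>. One majorant, an exponential series scaled by \<open>p ^ n\<close>, therefore
  serves all shifts at once. This gives convergence (with \<open>n = 0\<close>) and decay in \<open>n\<close>.
\<close>

lemma k_Clifford_terms_bound:
  assumes k: "k > 0" and p: "p > 0"
  obtains B where
    "\<And>n r. norm ((- c) ^ r * (1 / k_Gamma k (z + real n * k + real r * k)) / fact r * y ^ r)
       \<le> B * p ^ n * (inverse (fact r) * (\<bar>c * y\<bar> * p) ^ r)"
proof -
  obtain B where B: "\<And>n. \<bar>1 / k_Gamma k (z + real n * k)\<bar> \<le> B * p ^ n"
    using inverse_k_Gamma_bound[OF k p] by blast
  show ?thesis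
  proof (rule that)
    fix n r
    have "\<bar>1 / k_Gamma k (z + real n * k + real r * k)\<bar> \<le> B * p ^ (n + r)"
      using B[of "n + r"] by (simp add: algebra_simps)
    then have "\<bar>c * y\<bar> ^ r / fact r * \<bar>1 / k_Gamma k (z + real n * k + real r * k)\<bar>
        \<le> \<bar>c * y\<bar> ^ r / fact r * (B * p ^ (n + r))"
      by (intro mult_left_mono) auto
    then show "norm ((- c) ^ r * (1 / k_Gamma k (z + real n * k + real r * k)) / fact r * y ^ r)
       \<le> B * p ^ n * (inverse (fact r) * (\<bar>c * y\<bar> * p) ^ r)"
      by (simp add: abs_mult power_abs power_mult_distrib power_add field_simps)
  qed
qed

lemma summable_k_Clifford:
  assumes k: "k > 0"
  shows "summable (\<lambda>r. (- c) ^ r * (1 / k_Gamma k (z + real r * k)) / fact r * y ^ r)"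
proof -
  obtain B where "\<And>n r. norm ((- c) ^ r * (1 / k_Gamma k (z + real n * k + real r * k)) / fact r * y ^ r)
       \<le> B * 1 ^ n * (inverse (fact r) * (\<bar>c * y\<bar> * 1) ^ r)"
    using k_Clifford_terms_bound[OF k zero_less_one] by blast
  from this[of _ 0] show ?thesis
    by (intro summable_comparison_test'[OF summable_mult[OF summable_exp]]) auto
qed

lemma k_Clifford_decay:
  assumes k: "k > 0"
  shows "(\<lambda>n. q ^ n * k_Clifford k c (z + real n * k) y) \<longlonglongrightarrow> 0"
proof -
  \<comment> \<open>The rate \<open>p\<close> of the majorant may be as small as desired; here it has to beat the growth of \<open>q ^ n\<close>.\<close>
  define p where "p = 1 / (2 * (\<bar>q\<bar> + 1))"
  have p: "p > 0" "\<bar>q\<bar> * p < 1"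
    by (auto simp: p_def field_simps)
  obtain B where B:
    "\<And>n r. norm ((- c) ^ r * (1 / k_Gamma k (z + real n * k + real r * k)) / fact r * y ^ r)
       \<le> B * p ^ n * (inverse (fact r) * (\<bar>c * y\<bar> * p) ^ r)"
    using k_Clifford_terms_bound[OF k p(1)] by blast
  define E where "E = (\<Sum>r. inverse (fact r) * (\<bar>c * y\<bar> * p) ^ r)"
  have bound: "norm (k_Clifford k c (z + real n * k) y) \<le> B * p ^ n * E" for n
    unfolding k_Clifford_def E_def
    by (subst suminf_mult[OF summable_exp, symmetric])
       (intro norm_suminf_le B summable_mult summable_exp)
  have "(\<lambda>n. (\<bar>q\<bar> * p) ^ n * (B * E)) \<longlonglongrightarrow> 0 * (B * E)"
    using p by (intro tendsto_intros LIMSEQ_power_zero) auto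
  then show ?thesis
  proof (rule Lim_null_comparison[rotated, OF tendsto_eq_rhs], goal_cases)
    case 2
    have "norm (q ^ n * k_Clifford k c (z + real n * k) y) \<le> (\<bar>q\<bar> * p) ^ n * (B * E)" for n
      using mult_left_mono[OF bound[of n], of "\<bar>q\<bar> ^ n"]
      by (simp add: abs_mult power_abs power_mult_distrib mult_ac)
    then show ?case by simp
  qed simp
qed

lemma k_Clifford_has_derivative:
  assumes k: "k > 0"
  shows "(k_Clifford k c z has_real_derivative - c * k_Clifford k c (z + k) y) (at y)"
proof -
  define a where "a = (\<lambda>r. (- c) ^ r * (1 / k_Gamma k (z + real r * k)) / fact r)"
  have "diffs a r = - c * ((- c) ^ r * (1 / k_Gamma k (z + k + real r * k)) / fact r)" for r
    by (simp add: diffs_def a_def field_simps del: of_nat_Suc) (simp add: algebra_simps)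
  then have "(\<Sum>r. diffs a r * y ^ r) = - c * k_Clifford k c (z + k) y"
    unfolding k_Clifford_def
    by (subst suminf_mult[OF summable_k_Clifford[OF k], symmetric]) (simp add: mult_ac)
  moreover have "((\<lambda>y. \<Sum>r. a r * y ^ r) has_real_derivative (\<Sum>r. diffs a r * y ^ r)) (at y)"
    unfolding a_def by (intro termdiffs_strong_converges_everywhere summable_k_Clifford k)
  moreover have "k_Clifford k c z = (\<lambda>y. \<Sum>r. a r * y ^ r)"
    by (simp add: fun_eq_iff k_Clifford_def a_def)
  ultimately show ?thesis
    by simp
qed

text \<open>
  The factor \<open>z + r k\<close> supplied by the recurrence in the \<open>r\<close>-th coefficient is split into its two
  summands. The summand \<open>r k\<close> cancels against \<open>r!\<close>, which shifts the series by one index.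
\<close>

lemma k_Clifford_contiguous:
  assumes k: "k > 0"
  shows "k_Clifford k c z y
    = z * k_Clifford k c (z + k) y - c * k * y * k_Clifford k c (z + 2 * k) y"
proof -
  define a where "a = (\<lambda>z r. (- c) ^ r * (1 / k_Gamma k (z + real r * k)) / fact r * y ^ r)"
  have sums: "a w sums k_Clifford k c w y" for w
    unfolding a_def k_Clifford_def by (rule summable_sums[OF summable_k_Clifford[OF k]])
  have "(\<lambda>r. real r * a (z + k) r) sums (- c * y * k_Clifford k c (z + 2 * k) y)"
  proof -
    have "- c * y * a (z + 2 * k) r = real (Suc r) * a (z + k) (Suc r)" for r
      by (simp add: a_def field_simps del: of_nat_Suc) (simp add: algebra_simps)
    then have "(\<lambda>r. real (Suc r) * a (z + k) (Suc r)) sums (- c * y * k_Clifford k c (z + 2 * k) y)"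
      using sums_mult[OF sums[of "z + 2 * k"], of "- c * y"] by simp
    then show ?thesis
      by (subst (asm) sums_Suc_iff) simp
  qed
  then have "(\<lambda>r. z * a (z + k) r + k * (real r * a (z + k) r))
      sums (z * k_Clifford k c (z + k) y + k * (- c * y * k_Clifford k c (z + 2 * k) y))"
    by (intro sums_add sums_mult sums)
  moreover have "z * a (z + k) r + k * (real r * a (z + k) r) = a z r" for r
  proof -
    have "1 / k_Gamma k (z + real r * k) = (z + real r * k) * (1 / k_Gamma k (z + k + real r * k))"
      using inverse_k_Gamma_rec[OF k, of "z + real r * k"] by (simp add: algebra_simps)
    then show ?thesis
      unfolding a_def by (simp add: algebra_simps add_divide_distrib)
  qed
  ultimately have "a z sums (z * k_Clifford k c (z + k) y + k * (- c * y * k_Clifford k c (z + 2 * k) y))"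
    by simp
  from sums_unique2[OF sums this] show ?thesis
    by simp
qed

section \<open>Recurrence and derivative of the k-Bessel function\<close>

lemma k_Bessel_W_conv_k_Clifford:
  assumes k: "k > 0" and x: "x > 0"
  shows "k_Bessel_W k \<nu> c x = (x / 2) powr (\<nu> / k) * k_Clifford k c (\<nu> + k) ((x / 2)\<^sup>2)"
proof -
  have "(x / 2) powr (2 * real r + \<nu> / k) = (x / 2) powr (\<nu> / k) * ((x / 2)\<^sup>2) ^ r" for r
  proof -
    have "(x / 2) powr (2 * real r) = (x / 2) ^ (2 * r)"
      using x powr_realpow[of "x / 2" "2 * r"] by simp
    then show ?thesis
      by (simp add: powr_add power_mult)
  qed
  then show ?thesis
    unfolding k_Bessel_W_def k_Clifford_def
    by (subst suminf_mult[OF summable_k_Clifford[OF k], symmetric])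
       (intro suminf_cong, simp add: algebra_simps)
qed

text \<open>
  All orders congruent to \<open>\<nu>\<close> modulo \<open>k\<close> share the factor \<open>(x / 2) powr (\<nu> / k)\<close>, so relations
  between them become relations between integer powers of \<open>x / 2\<close>.
\<close>

lemma k_Bessel_W_shift:
  assumes "k > 0" "x > 0"
  shows "k_Bessel_W k (\<nu> + real_of_int j * k) c x
    = (x / 2) powr (\<nu> / k) * (x / 2) powi j
        * k_Clifford k c (\<nu> + real_of_int (j + 1) * k) ((x / 2)\<^sup>2)"
proof -
  have "(x / 2) powr ((\<nu> + real_of_int j * k) / k) = (x / 2) powr (\<nu> / k) * (x / 2) powi j"
    using assms by (simp add: add_divide_distrib powr_add powr_real_of_int')
  moreover have "\<nu> + real_of_int j * k + k = \<nu> + real_of_int (j + 1) * k"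
    by (simp add: algebra_simps)
  ultimately show ?thesis
    using k_Bessel_W_conv_k_Clifford[OF assms, of "\<nu> + real_of_int j * k" c] by metis
qed

lemma k_Bessel_W_recurrence:
  assumes k: "k > 0" and x: "x > 0"
  shows "2 * \<nu> * k_Bessel_W k \<nu> c x
      = x * k_Bessel_W k (\<nu> - k) c x + x * c * k * k_Bessel_W k (\<nu> + k) c x"
proof -
  define P where "P = (x / 2) powr (\<nu> / k)"
  define F where "F = (\<lambda>z. k_Clifford k c z ((x / 2)\<^sup>2))"
  have 0: "k_Bessel_W k \<nu> c x = P * F (\<nu> + k)"
    using k_Bessel_W_shift[OF k x, of \<nu> 0 c] by (simp add: P_def F_def)
  have minus: "x * k_Bessel_W k (\<nu> - k) c x = 2 * (P * F \<nu>)"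
    using k_Bessel_W_shift[OF k x, of \<nu> "-1" c] x by (simp add: P_def F_def)
  have plus: "k_Bessel_W k (\<nu> + k) c x = P * (x / 2) * F (\<nu> + 2 * k)"
    using k_Bessel_W_shift[OF k x, of \<nu> 1 c] by (simp add: P_def F_def)
  have F: "F \<nu> = \<nu> * F (\<nu> + k) - c * k * (x / 2)\<^sup>2 * F (\<nu> + 2 * k)"
    unfolding F_def by (rule k_Clifford_contiguous[OF k])
  show ?thesis
    unfolding minus 0 plus F by (simp add: algebra_simps power2_eq_square)
qed

text \<open>
  Up to the constant \<open>2 powr (- \<nu> / k)\<close>, the product is the entire factor of the Bessel function
  evaluated at \<open>(t / 2)\<^sup>2\<close>, so the chain rule applies. The equality holds only for \<open>t > 0\<close>, which
  suffices locally.
\<close>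

lemma has_derivative_powr_minus_mult_k_Bessel_W:
  assumes k: "k > 0" and x: "x > 0"
  shows "((\<lambda>t. t powr (- \<nu> / k) * k_Bessel_W k \<nu> c t) has_real_derivative
       - c * x powr (- \<nu> / k) * k_Bessel_W k (\<nu> + k) c x) (at x)"
proof -
  have cancel: "t powr (- \<nu> / k) * (t / 2) powr (\<nu> / k) = 2 powr (- \<nu> / k)" if "t > 0" for t
    using that by (simp add: powr_divide powr_minus field_simps)
  have "((\<lambda>t. (t / 2)\<^sup>2) has_real_derivative x / 2) (at x)"
    by (auto intro!: derivative_eq_intros)
  then have "((\<lambda>t. 2 powr (- \<nu> / k) * k_Clifford k c (\<nu> + k) ((t / 2)\<^sup>2)) has_real_derivative
      2 powr (- \<nu> / k) * (- c * k_Clifford k c (\<nu> + k + k) ((x / 2)\<^sup>2) * (x / 2))) (at x)"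
    by (intro DERIV_cmult DERIV_chain2[OF k_Clifford_has_derivative[OF k]])
  also have "2 powr (- \<nu> / k) * (- c * k_Clifford k c (\<nu> + k + k) ((x / 2)\<^sup>2) * (x / 2))
      = - c * x powr (- \<nu> / k) * k_Bessel_W k (\<nu> + k) c x"
  proof -
    have "k_Bessel_W k (\<nu> + k) c x
        = (x / 2) powr (\<nu> / k) * (x / 2) * k_Clifford k c (\<nu> + k + k) ((x / 2)\<^sup>2)"
      using k_Bessel_W_shift[OF k x, of \<nu> 1 c] by (simp add: add.assoc)
    then show ?thesis
      unfolding cancel[OF x, symmetric] by (simp only: mult_ac mult_minus_left mult_minus_right)
  qed
  finally show ?thesis
  proof (rule has_field_derivative_transform_within_open[of _ _ _ "{0<..}"])
    fix t :: real assume "t \<in> {0<..}"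
    then show "2 powr (- \<nu> / k) * k_Clifford k c (\<nu> + k) ((t / 2)\<^sup>2)
        = t powr (- \<nu> / k) * k_Bessel_W k \<nu> c t"
      using k cancel[of t] by (simp add: k_Bessel_W_conv_k_Clifford)
  qed (use x in auto)
qed

text \<open>
  The order-raising formula \<open>W' \<nu> = \<nu> / (k x) W \<nu> - c W (\<nu> + k)\<close> comes from the product rule; the
  three-term recurrence replaces its first term. Unlike that formula, the result has constant
  coefficients and can be iterated.
\<close>

lemma k_Bessel_W_has_derivative:
  assumes k: "k > 0" and x: "x > 0"
  shows "(k_Bessel_W k \<nu> c has_real_derivative
    (k_Bessel_W k (\<nu> - k) c x - c * k * k_Bessel_W k (\<nu> + k) c x) / (2 * k)) (at x)"
proof -
  define V where "V = (\<lambda>t. t powr (- \<nu> / k) * k_Bessel_W k \<nu> c t)"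
  have cancel: "t powr (\<nu> / k) * t powr (- \<nu> / k) = 1" if "t > 0" for t
    using that by (simp add: powr_minus)
  have V: "(V has_real_derivative - c * x powr (- \<nu> / k) * k_Bessel_W k (\<nu> + k) c x) (at x)"
    unfolding V_def by (rule has_derivative_powr_minus_mult_k_Bessel_W[OF k x])
  have "((\<lambda>t. t powr (\<nu> / k) * V t) has_real_derivative
      x powr (\<nu> / k) * (- c * x powr (- \<nu> / k) * k_Bessel_W k (\<nu> + k) c x)
      + \<nu> / k * x powr (\<nu> / k - 1) * V x) (at x)"
    by (rule DERIV_mult'[OF has_real_derivative_powr[OF x] V])
  also have "x powr (\<nu> / k) * (- c * x powr (- \<nu> / k) * k_Bessel_W k (\<nu> + k) c x)
      + \<nu> / k * x powr (\<nu> / k - 1) * V x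
      = (x powr (\<nu> / k) * x powr (- \<nu> / k))
        * (\<nu> / (k * x) * k_Bessel_W k \<nu> c x - c * k_Bessel_W k (\<nu> + k) c x)"
    using x by (simp add: V_def powr_diff field_simps)
  also have "\<dots> = (k_Bessel_W k (\<nu> - k) c x - c * k * k_Bessel_W k (\<nu> + k) c x) / (2 * k)"
    unfolding cancel[OF x] using k_Bessel_W_recurrence[OF k x, of \<nu> c] k x
    by (simp add: field_simps)
  finally show ?thesis
  proof (rule has_field_derivative_transform_within_open[of _ _ _ "{0<..}"])
    fix t :: real assume "t \<in> {0<..}"
    then show "t powr (\<nu> / k) * V t = k_Bessel_W k \<nu> c t"
      using cancel[of t] by (simp add: V_def flip: mult.assoc)
  qed (use x in auto)
qed

lemma has_derivative_powr_mult_k_Bessel_W: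
  assumes k: "k > 0" and x: "x > 0"
  shows "((\<lambda>t. t powr (\<nu> / k) * k_Bessel_W k \<nu> c t) has_real_derivative
       x powr (\<nu> / k) / k * k_Bessel_W k (\<nu> - k) c x) (at x)"
proof -
  have "((\<lambda>t. t powr (\<nu> / k) * k_Bessel_W k \<nu> c t) has_real_derivative
      x powr (\<nu> / k) * ((k_Bessel_W k (\<nu> - k) c x - c * k * k_Bessel_W k (\<nu> + k) c x) / (2 * k))
      + \<nu> / k * x powr (\<nu> / k - 1) * k_Bessel_W k \<nu> c x) (at x)"
    by (rule DERIV_mult'[OF has_real_derivative_powr[OF x] k_Bessel_W_has_derivative[OF k x]])
  also have "x powr (\<nu> / k) * ((k_Bessel_W k (\<nu> - k) c x - c * k * k_Bessel_W k (\<nu> + k) c x) / (2 * k))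
      + \<nu> / k * x powr (\<nu> / k - 1) * k_Bessel_W k \<nu> c x
      = x powr (\<nu> / k) / (2 * k * x) * (x * k_Bessel_W k (\<nu> - k) c x
          - x * c * k * k_Bessel_W k (\<nu> + k) c x + 2 * \<nu> * k_Bessel_W k \<nu> c x)"
  proof -
    have "x powr (\<nu> / k - 1) = x powr (\<nu> / k) / x"
      using x by (simp add: powr_diff)
    then show ?thesis
      using k x by (simp add: field_simps)
  qed
  also have "\<dots> = x powr (\<nu> / k) / k * k_Bessel_W k (\<nu> - k) c x"
    unfolding k_Bessel_W_recurrence[OF k x] using k x by (simp add: field_simps)
  finally show ?thesis .
qed

lemma power_uminus_mult_distrib:
  fixes c k :: "'a :: comm_ring_1"
  shows "(- (c * k)) ^ n = (-1) ^ n * c ^ n * k ^ n"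
proof -
  have "(- (c * k)) ^ n = ((-1) * c * k) ^ n"
    by simp
  also have "\<dots> = (-1) ^ n * c ^ n * k ^ n"
    by (simp only: power_mult_distrib)
  finally show ?thesis .
qed

section \<open>The series over shifted orders\<close>

text \<open>
  The power \<open>(x / 2) ^ (2 r)\<close> contained in the Bessel function and the factor \<open>(c k) ^ r\<close> are
  both geometric in \<open>r\<close>, so they are absorbed into the superexponential decay of the entire factor.
\<close>

lemma k_Bessel_W_tail_tendsto_0:
  assumes k: "k > 0" and x: "x > 0"
  shows "(\<lambda>r. (- (c * k)) ^ r * k_Bessel_W k (\<nu> - k + 2 * real r * k) c x) \<longlonglongrightarrow> 0"
proof -
  define P where "P = (x / 2) powr (\<nu> / k - 1)"
  \<comment> \<open>The order grows by \<open>2 k\<close> per step, so only the even terms of the decaying sequence occur;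
     the square root makes \<open>q ^ (2 * r)\<close> match the factors present.\<close>
  define q where "q = sqrt \<bar>c * k\<bar> * (x / 2)"
  define F where "F = (\<lambda>n. k_Clifford k c (\<nu> + real n * k) ((x / 2)\<^sup>2))"
  have W: "k_Bessel_W k (\<nu> - k + 2 * real r * k) c x = P * (x / 2) ^ (2 * r) * F (2 * r)" for r
  proof -
    have "k_Bessel_W k (\<nu> - k + real_of_int (int (2 * r)) * k) c x
        = (x / 2) powr ((\<nu> - k) / k) * (x / 2) powi int (2 * r)
          * k_Clifford k c (\<nu> - k + real_of_int (int (2 * r) + 1) * k) ((x / 2)\<^sup>2)"
      by (rule k_Bessel_W_shift[OF k x])
    moreover have "(x / 2) powi int (2 * r) = (x / 2) ^ (2 * r)"
      by (rule power_int_of_nat)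
    moreover have "(\<nu> - k) / k = \<nu> / k - 1"
      using k by (simp add: diff_divide_distrib)
    moreover have "\<nu> - k + real_of_int (int (2 * r)) * k = \<nu> - k + 2 * real r * k"
      by simp
    moreover have "\<nu> - k + real_of_int (int (2 * r) + 1) * k = \<nu> + real (2 * r) * k"
      by (simp add: algebra_simps)
    ultimately show ?thesis
      by (simp only: P_def F_def)
  qed
  have "q ^ (2 * r) = \<bar>c * k\<bar> ^ r * (x / 2) ^ (2 * r)" for r
    unfolding q_def power_mult_distrib by (simp add: power_mult)
  then have "\<bar>(- (c * k)) ^ r * k_Bessel_W k (\<nu> - k + 2 * real r * k) c x\<bar>
      = \<bar>P * (q ^ (2 * r) * F (2 * r))\<bar>" for r
    unfolding W by (simp add: abs_mult power_abs mult_ac)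
  moreover have "(\<lambda>n. q ^ n * F n) \<longlonglongrightarrow> 0"
    unfolding F_def by (rule k_Clifford_decay[OF k])
  then have "(\<lambda>r. q ^ (2 * r) * F (2 * r)) \<longlonglongrightarrow> 0"
    by (rule LIMSEQ_subseq_LIMSEQ[unfolded o_def, where f = "\<lambda>r. 2 * r"]) (auto simp: strict_mono_def)
  then have "(\<lambda>r. \<bar>P * (q ^ (2 * r) * F (2 * r))\<bar>) \<longlonglongrightarrow> 0"
    by (intro tendsto_rabs_zero tendsto_mult_right_zero)
  ultimately show ?thesis
    by (subst tendsto_rabs_zero_iff[symmetric]) simp
qed

text \<open>
  The recurrence writes the \<open>r\<close>-th term as \<open>x / 2\<close> times the difference of two consecutive values
  of the sequence that was just shown to vanish in the limit.
\<close>

lemma k_Bessel_W_Neumann_series: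
  assumes k: "k > 0" and x: "x > 0"
  shows "(\<lambda>r. (-1) ^ r * c ^ r * k ^ r * (\<nu> + 2 * real r * k) * k_Bessel_W k (\<nu> + 2 * real r * k) c x)
    sums (x / 2 * k_Bessel_W k (\<nu> - k) c x)"
proof -
  define T where "T = (\<lambda>r. (- (c * k)) ^ r * k_Bessel_W k (\<nu> - k + 2 * real r * k) c x)"
  have "(\<lambda>r. x / 2 * (T r - T (Suc r))) sums (x / 2 * (T 0 - 0))"
    unfolding T_def by (intro sums_mult telescope_sums' k_Bessel_W_tail_tendsto_0 k x)
  moreover have "x / 2 * (T r - T (Suc r))
      = (-1) ^ r * c ^ r * k ^ r * (\<nu> + 2 * real r * k) * k_Bessel_W k (\<nu> + 2 * real r * k) c x" for r
  proof -
    define \<mu> where "\<mu> = \<nu> + 2 * real r * k"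
    have "\<nu> - k + 2 * real r * k = \<mu> - k" "\<nu> - k + 2 * real (Suc r) * k = \<mu> + k"
      by (simp_all add: \<mu>_def algebra_simps)
    then have "x / 2 * (T r - T (Suc r)) = (- (c * k)) ^ r / 2 *
        (x * k_Bessel_W k (\<mu> - k) c x + x * c * k * k_Bessel_W k (\<mu> + k) c x)"
      by (simp add: T_def algebra_simps)
    also have "\<dots> = (- (c * k)) ^ r * \<mu> * k_Bessel_W k \<mu> c x"
      by (simp add: k_Bessel_W_recurrence[OF k x, symmetric])
    also have "(- (c * k)) ^ r = (-1) ^ r * c ^ r * k ^ r"
      by (rule power_uminus_mult_distrib)
    finally show ?thesis
      by (simp add: \<mu>_def)
  qed
  ultimately show ?thesis
    by (simp add: T_def)
qed

section \<open>Higher derivatives\<close>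

text \<open>
  This is Pascal's rule in the form \<open>(1 + a S) ^ Suc m = (1 + a S) ^ m (1 + a S)\<close> where \<open>S\<close> shifts
  the sequence \<open>G\<close> by one place.
\<close>

lemma binomial_sum_Suc:
  fixes a :: "'a :: comm_ring_1"
  shows "(\<Sum>n\<le>Suc m. of_nat (Suc m choose n) * a ^ n * G n)
    = (\<Sum>n\<le>m. of_nat (m choose n) * a ^ n * (G n + a * G (Suc n)))"
proof -
  have "(\<Sum>n\<le>Suc m. of_nat (Suc m choose n) * a ^ n * G n)
      = G 0 + (\<Sum>n\<le>m. of_nat (m choose Suc n) * a ^ Suc n * G (Suc n))
        + (\<Sum>n\<le>m. of_nat (m choose n) * a ^ Suc n * G (Suc n))"
    by (subst sum.atMost_Suc_shift) (simp add: algebra_simps sum.distrib)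
  also have "G 0 + (\<Sum>n\<le>m. of_nat (m choose Suc n) * a ^ Suc n * G (Suc n))
      = (\<Sum>n\<le>Suc m. of_nat (m choose n) * a ^ n * G n)"
    by (subst sum.atMost_Suc_shift) simp
  also have "\<dots> = (\<Sum>n\<le>m. of_nat (m choose n) * a ^ n * G n)"
    by (simp add: binomial_eq_0)
  finally show ?thesis
    by (simp add: algebra_simps sum.distrib)
qed

definition k_Bessel_W_nth_deriv :: "real \<Rightarrow> real \<Rightarrow> real \<Rightarrow> nat \<Rightarrow> real \<Rightarrow> real" where
  "k_Bessel_W_nth_deriv k \<nu> c m x = 1 / (2 * k) ^ m *
     (\<Sum>n\<le>m. real (m choose n) * (- (c * k)) ^ n * k_Bessel_W k (\<nu> - real m * k + 2 * real n * k) c x)"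

text \<open>
  Differentiating the \<open>n\<close>-th summand produces the orders \<open>\<nu> - (m + 1) k + 2 n k\<close> and, one step up in
  \<open>n\<close>, \<open>\<nu> - (m + 1) k + 2 (n + 1) k\<close>. Both lie in the family of orders occurring for \<open>m + 1\<close>, and
  Pascal's rule collects the coefficients.
\<close>

lemma k_Bessel_W_nth_deriv_has_derivative:
  assumes k: "k > 0" and x: "x > 0"
  shows "(k_Bessel_W_nth_deriv k \<nu> c m has_real_derivative k_Bessel_W_nth_deriv k \<nu> c (Suc m) x) (at x)"
proof -
  define G where "G = (\<lambda>n. k_Bessel_W k (\<nu> - real (Suc m) * k + 2 * real n * k) c x)"
  have W: "(k_Bessel_W k (\<nu> - real m * k + 2 * real n * k) c has_real_derivative
      (G n + - (c * k) * G (Suc n)) / (2 * k)) (at x)" for n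
  proof -
    define \<mu> where "\<mu> = \<nu> - real m * k + 2 * real n * k"
    have "G n = k_Bessel_W k (\<mu> - k) c x" "G (Suc n) = k_Bessel_W k (\<mu> + k) c x"
      by (simp_all add: G_def \<mu>_def algebra_simps)
    then show ?thesis
      using k_Bessel_W_has_derivative[OF k x, of \<mu> c] by (simp add: \<mu>_def)
  qed
  have "((\<lambda>x. k_Bessel_W_nth_deriv k \<nu> c m x) has_real_derivative 1 / (2 * k) ^ m *
     (\<Sum>n\<le>m. real (m choose n) * (- (c * k)) ^ n * ((G n + - (c * k) * G (Suc n)) / (2 * k)))) (at x)"
    unfolding k_Bessel_W_nth_deriv_def by (intro DERIV_cmult DERIV_sum W)
  also have "1 / (2 * k) ^ m *
     (\<Sum>n\<le>m. real (m choose n) * (- (c * k)) ^ n * ((G n + - (c * k) * G (Suc n)) / (2 * k)))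
     = 1 / (2 * k) ^ Suc m *
     (\<Sum>n\<le>m. real (m choose n) * (- (c * k)) ^ n * (G n + - (c * k) * G (Suc n)))"
    by (simp add: sum_divide_distrib)
  also have "\<dots> = k_Bessel_W_nth_deriv k \<nu> c (Suc m) x"
    unfolding k_Bessel_W_nth_deriv_def binomial_sum_Suc[of m "- (c * k)" G, symmetric]
    by (simp only: G_def)
  finally show ?thesis .
qed

text \<open>
  The two claims are proved together: the value of the next iterated derivative comes from the
  derivative of the current one, whose existence in turn needs the closed form on a whole
  neighbourhood of \<open>x\<close>.
\<close>

lemma higher_deriv_k_Bessel_W:
  assumes k: "k > 0"
  shows "x > 0 \<Longrightarrow> (deriv ^^ m) (k_Bessel_W k \<nu> c) x = k_Bessel_W_nth_deriv k \<nu> c m x"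
    and "x > 0 \<Longrightarrow> ((deriv ^^ m) (k_Bessel_W k \<nu> c) has_real_derivative
      k_Bessel_W_nth_deriv k \<nu> c (Suc m) x) (at x)"
proof (induction m arbitrary: x)
  case 0
  {
    case 1
    show ?case by (simp add: k_Bessel_W_nth_deriv_def)
  next
    case 2
    have "k_Bessel_W_nth_deriv k \<nu> c 0 = k_Bessel_W k \<nu> c"
      by (simp add: k_Bessel_W_nth_deriv_def fun_eq_iff)
    then show ?case
      using k_Bessel_W_nth_deriv_has_derivative[OF k 2, of \<nu> c 0] by simp
  }
next
  case (Suc m)
  have eq: "(deriv ^^ Suc m) (k_Bessel_W k \<nu> c) t = k_Bessel_W_nth_deriv k \<nu> c (Suc m) t"
    if "t > 0" for t
    using DERIV_imp_deriv[OF Suc.IH(2)[OF that]] by simp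
  {
    case 1
    then show ?case by (rule eq)
  next
    case 2
    show ?case
      by (rule has_field_derivative_transform_within_open[
            OF k_Bessel_W_nth_deriv_has_derivative[OF k 2], of "{0<..}"])
         (use 2 eq in auto)
  }
qed

theorem proposition2p2:
  fixes k \<nu> c :: real
  assumes "k > 0" and "\<nu> > - k"
  shows "\<forall>x>0.
    2 * \<nu> * k_Bessel_W k \<nu> c x
      = x * k_Bessel_W k (\<nu> - k) c x + x * c * k * k_Bessel_W k (\<nu> + k) c x
    \<and>
    (summable (\<lambda>r. (-1) ^ r * c ^ r * k ^ r * (\<nu> + 2 * real r * k)
                    * k_Bessel_W k (\<nu> + 2 * real r * k) c x) \<and>
     k_Bessel_W k (\<nu> - k) c x
      = 2 / x * (\<Sum>r. (-1) ^ r * c ^ r * k ^ r * (\<nu> + 2 * real r * k)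
                      * k_Bessel_W k (\<nu> + 2 * real r * k) c x))
    \<and>
    ((\<lambda>t. t powr (\<nu> / k) * k_Bessel_W k \<nu> c t) has_real_derivative
       x powr (\<nu> / k) / k * k_Bessel_W k (\<nu> - k) c x) (at x)
    \<and>
    ((\<lambda>t. t powr (- \<nu> / k) * k_Bessel_W k \<nu> c t) has_real_derivative
       - c * x powr (- \<nu> / k) * k_Bessel_W k (\<nu> + k) c x) (at x)
    \<and>
    (\<forall>m\<ge>1.
      (\<forall>j<m. (deriv ^^ j) (k_Bessel_W k \<nu> c) differentiable (at x)) \<and>
      (deriv ^^ m) (k_Bessel_W k \<nu> c) x
        = 1 / (2 ^ m * k ^ m)
          * (\<Sum>n=0..m. (-1) ^ n * real (m choose n) * c ^ n * k ^ n
               * k_Bessel_W k (\<nu> - real m * k + 2 * real n * k) c x))"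
proof (intro allI impI conjI)
  fix x :: real assume x: "x > 0"
  note k = \<open>k > 0\<close>
  show "2 * \<nu> * k_Bessel_W k \<nu> c x
      = x * k_Bessel_W k (\<nu> - k) c x + x * c * k * k_Bessel_W k (\<nu> + k) c x"
    by (rule k_Bessel_W_recurrence[OF k x])
  note series = k_Bessel_W_Neumann_series[OF k x, of c \<nu>]
  show "summable (\<lambda>r. (-1) ^ r * c ^ r * k ^ r * (\<nu> + 2 * real r * k)
                    * k_Bessel_W k (\<nu> + 2 * real r * k) c x)"
    by (rule sums_summable[OF series])
  show "k_Bessel_W k (\<nu> - k) c x
      = 2 / x * (\<Sum>r. (-1) ^ r * c ^ r * k ^ r * (\<nu> + 2 * real r * k)
                      * k_Bessel_W k (\<nu> + 2 * real r * k) c x)"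
    using x by (simp add: sums_unique[OF series, symmetric])
  show "((\<lambda>t. t powr (\<nu> / k) * k_Bessel_W k \<nu> c t) has_real_derivative
       x powr (\<nu> / k) / k * k_Bessel_W k (\<nu> - k) c x) (at x)"
    by (rule has_derivative_powr_mult_k_Bessel_W[OF k x])
  show "((\<lambda>t. t powr (- \<nu> / k) * k_Bessel_W k \<nu> c t) has_real_derivative
       - c * x powr (- \<nu> / k) * k_Bessel_W k (\<nu> + k) c x) (at x)"
    by (rule has_derivative_powr_minus_mult_k_Bessel_W[OF k x])
  fix m :: nat assume "m \<ge> 1"
  show "(deriv ^^ j) (k_Bessel_W k \<nu> c) differentiable (at x)" for j
    unfolding real_differentiable_def using higher_deriv_k_Bessel_W(2)[OF k x] by blast
  show "(deriv ^^ m) (k_Bessel_W k \<nu> c) x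
        = 1 / (2 ^ m * k ^ m)
          * (\<Sum>n=0..m. (-1) ^ n * real (m choose n) * c ^ n * k ^ n
               * k_Bessel_W k (\<nu> - real m * k + 2 * real n * k) c x)"
    by (simp add: higher_deriv_k_Bessel_W(1)[OF k x] k_Bessel_W_nth_deriv_def
        power_uminus_mult_distrib power_mult_distrib atMost_atLeast0 mult_ac)
qed

end
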